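(* Let $ABC$ be a fixed acute triangle in the Euclidean plane inscribed in a circle $\omega$ with center $O$. For a point $X$ on the minor arc $AB$ of $\omega$ (with $X \neq A, B$), let $D$ be the intersection point of segments $CX$ and $AB$, and let $O_1$ and $O_2$ be the circumcenters of triangles $ADX$ and $BDX$, respectively. Then, as $X$ varies over the minor arc $AB$, the area of triangle $OO_1O_2$ attains its minimum at exactly one point $X$, namely the unique point $X$ on the minor arc $AB$ for which $CX \perp AB$.
   Context: The minor arc $AB$ of $\omega$ is the arc of $\omega$ with endpoints $A$ and $B$ that does not contain $C$. *)

theory Defs
  imports "HOL-Analysis.Analysis"
begin

text \<open>The Euclidean plane is \<^typ>\<open>real^2\<close>; \<open>angle_at P Q R\<close> is the unoriented
  angle with vertex \<open>Q\<close>.\<close>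

definition angle_at :: "real^2 \<Rightarrow> real^2 \<Rightarrow> real^2 \<Rightarrow> real" where
  "angle_at P Q R = arccos (((P - Q) \<bullet> (R - Q)) / (norm (P - Q) * norm (R - Q)))"

definition acute_triangle :: "real^2 \<Rightarrow> real^2 \<Rightarrow> real^2 \<Rightarrow> bool" where
  "acute_triangle A B C \<longleftrightarrow>
     \<not> collinear {A, B, C} \<and>
     angle_at B A C < pi / 2 \<and> angle_at A B C < pi / 2 \<and> angle_at A C B < pi / 2"

text \<open>The arc of the circle \<open>\<omega>\<close> with endpoints \<open>A\<close> and \<open>B\<close> that does not contain \<open>C\<close>, as
  a point set including \<open>A\<close> and \<open>B\<close>: the points lying on a simple path in \<open>\<omega>\<close> from \<open>A\<close> to
  \<open>B\<close> that misses \<open>C\<close>.  When \<open>A\<close>, \<open>B\<close>, \<open>C\<close> are distinct points of \<open>\<omega>\<close>, all such paths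
  have the same image.\<close>

definition minor_arc :: "(real^2) set \<Rightarrow> real^2 \<Rightarrow> real^2 \<Rightarrow> real^2 \<Rightarrow> (real^2) set" where
  "minor_arc \<omega> A B C =
     {X. \<exists>g. arc g \<and> pathstart g = A \<and> pathfinish g = B \<and>
             path_image g \<subseteq> \<omega> \<and> C \<notin> path_image g \<and> X \<in> path_image g}"

definition segments_meet :: "real^2 \<Rightarrow> real^2 \<Rightarrow> real^2 \<Rightarrow> real^2 \<Rightarrow> real^2" where
  "segments_meet P Q R S = (THE D. D \<in> closed_segment P Q \<inter> closed_segment R S)"

definition circumcenter :: "real^2 \<Rightarrow> real^2 \<Rightarrow> real^2 \<Rightarrow> real^2" where
  "circumcenter P Q R = (THE Z. \<exists>\<rho>. {P, Q, R} \<subseteq> sphere Z \<rho>)"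

definition triangle_area :: "real^2 \<Rightarrow> real^2 \<Rightarrow> real^2 \<Rightarrow> real" where
  "triangle_area P Q R = measure lborel (convex hull {P, Q, R})"

definition area_OO1O2 :: "real^2 \<Rightarrow> real^2 \<Rightarrow> real^2 \<Rightarrow> real^2 \<Rightarrow> real^2 \<Rightarrow> real" where
  "area_OO1O2 Z A B C X =
     (let D = segments_meet C X A B;
          O1 = circumcenter A D X;
          O2 = circumcenter B D X
      in triangle_area Z O1 O2)"

end

theory Submission
  imports Defs
begin

text \<open>Projecting \<open>O\<^sub>1O\<^sub>2\<close> onto \<open>AB\<close> gives a segment of length \<open>AB/2\<close>, since \<open>O\<^sub>1\<close> and \<open>O\<^sub>2\<close> project to
  the midpoints of \<open>AD\<close> and \<open>DB\<close>; also \<open>O\<^sub>1O\<^sub>2\<close> is perpendicular to \<open>CX\<close>. As \<open>OO\<^sub>1\<close> and \<open>OO\<^sub>2\<close> are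
  perpendicular to \<open>AX\<close> and \<open>BX\<close>, the triangle \<open>OO\<^sub>1O\<^sub>2\<close> is similar to \<open>CBA\<close>, and its area is
  \<open>[ABC] / (4 sin\<^sup>2 \<theta>)\<close> where \<open>\<theta>\<close> is the angle between \<open>CX\<close> and \<open>AB\<close>. This is minimal exactly
  when \<open>\<theta>\<close> is a right angle.

  The open arc is the set of points of the circle on the other side of \<open>AB\<close> from \<open>C\<close>: projecting
  stereographically from \<open>C\<close>, a simple path avoiding \<open>C\<close> becomes a strictly monotone function.\<close>

section \<open>Plane vector algebra: cross product and quarter turn\<close>

definition cross2 :: "real^2 \<Rightarrow> real^2 \<Rightarrow> real" where
  "cross2 p q = p$1 * q$2 - p$2 * q$1"

text \<open>The counterclockwise quarter turn, so that
  \<open>cross2 p q = perp p \<bullet> q\<close>.\<close>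

definition perp :: "real^2 \<Rightarrow> real^2" where
  "perp p = vector [- p$2, p$1]"

lemma perp_nth [simp]: "perp p $ 1 = - p$2" "perp p $ 2 = p$1"
  by (simp_all add: perp_def)

lemma inner_real2: "p \<bullet> q = p$1 * q$1 + p$2 * q$2" for p q :: "real^2"
  by (simp add: inner_vec_def sum_2)

lemma eq_real2_iff: "p = q \<longleftrightarrow> p$1 = q$1 \<and> p$2 = q$2" for p q :: "real^2"
  by (simp add: vec_eq_iff forall_2)

text \<open>Lagrange's identity: sin^2 + cos^2 = 1 for the angle between two vectors. It later
  brings the angle between \<open>CX\<close> and \<open>AB\<close> into the area.\<close>

lemma cross2_lagrange: "(cross2 p q)\<^sup>2 + (p \<bullet> q)\<^sup>2 = (p \<bullet> p) * (q \<bullet> q)"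
  unfolding cross2_def inner_real2 by algebra

lemma orthogonal_imp_perp:
  assumes "p \<bullet> q = 0" "q \<noteq> 0"
  obtains c where "p = c *\<^sub>R perp q"
proof
  have q: "q \<bullet> q \<noteq> 0" using assms by simp
  have "(q \<bullet> q) * p$1 = cross2 q p * - q$2" "(q \<bullet> q) * p$2 = cross2 q p * q$1"
    using assms(1) unfolding cross2_def inner_real2 by algebra+
  then show "p = (cross2 q p / (q \<bullet> q)) *\<^sub>R perp q"
    using q by (simp add: eq_real2_iff field_simps)
qed

lemma cross2_eq_0_imp_scaleR:
  assumes "cross2 p q = 0" "p \<noteq> 0"
  obtains c where "q = c *\<^sub>R p"
proof -
  have "q \<bullet> perp p = 0" "perp p \<noteq> 0"
    using assms by (auto simp: inner_real2 cross2_def eq_real2_iff mult.commute)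
  then obtain c where "q = c *\<^sub>R perp (perp p)"
    by (rule orthogonal_imp_perp)
  then have "q = (- c) *\<^sub>R p" by (simp add: eq_real2_iff)
  then show ?thesis by (rule that)
qed

lemma collinear_iff_cross2: "collinear {A, B, C} \<longleftrightarrow> cross2 (B - A) (C - A) = 0" for A B C :: "real^2"
proof (cases "B = A")
  case True
  then show ?thesis by (simp add: cross2_def)
next
  case False
  have "collinear {A, B, C} \<longleftrightarrow> collinear {B, A, C}" by (simp add: insert_commute)
  also have "\<dots> \<longleftrightarrow> collinear {0, B - A, C - A}" by (rule collinear_3) simp
  also have "\<dots> \<longleftrightarrow> cross2 (B - A) (C - A) = 0"
  proof
    show "cross2 (B - A) (C - A) = 0" if "collinear {0, B - A, C - A}"
      using that[unfolded collinear_lemma] by (auto simp: cross2_def eq_real2_iff)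
    show "collinear {0, B - A, C - A}" if "cross2 (B - A) (C - A) = 0"
      unfolding collinear_lemma using cross2_eq_0_imp_scaleR[OF that] False by (metis eq_iff_diff_eq_0)
  qed
  finally show ?thesis .
qed

section \<open>Angles, areas and circumcenters in terms of vectors\<close>

text \<open>\<open>arccos\<close> is decreasing on [-1, 1] and \<open>arccos 0 = pi / 2\<close>;
  Cauchy-Schwarz keeps the quotient in that interval.\<close>

lemma angle_acute_imp_inner_pos:
  assumes "angle_at P Q R < pi / 2" "P \<noteq> Q" "R \<noteq> Q"
  shows "(P - Q) \<bullet> (R - Q) > 0"
proof (rule ccontr)
  define y where "y = ((P - Q) \<bullet> (R - Q)) / (norm (P - Q) * norm (R - Q))"
  assume "\<not> ?thesis"
  then have "y \<le> 0" by (simp add: y_def divide_nonpos_nonneg)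
  moreover have "\<bar>y\<bar> \<le> 1"
    using assms Cauchy_Schwarz_ineq2[of "P - Q" "R - Q"] by (simp add: y_def abs_mult)
  ultimately have "arccos 0 \<le> arccos y" by (intro arccos_le_arccos) auto
  then show False using assms(1) by (simp add: angle_at_def y_def)
qed

lemma triangle_area_cross2: "triangle_area P Q R = \<bar>cross2 (Q - P) (R - P)\<bar> / 2"
  unfolding triangle_area_def content_triangle cross2_def
  by (simp add: abs_minus_commute mult.commute)

text \<open>Perpendicular bisector: \<open>W\<close> projects onto the midpoint of the chord from
  \<open>P\<close> to \<open>Y\<close>. This makes equidistance linear in \<open>W\<close>.\<close>

lemma dist_eq_iff_inner:
  fixes W P Y :: "'a::real_inner"
  shows "dist W P = dist W Y \<longleftrightarrow> 2 * ((W - P) \<bullet> (Y - P)) = (Y - P) \<bullet> (Y - P)"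
proof -
  have "dist W P = dist W Y \<longleftrightarrow> (W - P) \<bullet> (W - P) = (W - P - (Y - P)) \<bullet> (W - P - (Y - P))"
    by (simp add: dist_norm norm_eq)
  then show ?thesis by (auto simp: inner_diff_left inner_diff_right inner_commute)
qed

lemma circumcenter_equidistant:
  assumes "\<not> collinear {P, Q, R}"
  shows "dist (circumcenter P Q R) P = dist (circumcenter P Q R) Q"
    and "dist (circumcenter P Q R) P = dist (circumcenter P Q R) R"
proof -
  define q r where "q = Q - P" and "r = R - P"
  have k: "cross2 q r \<noteq> 0" using assms unfolding collinear_iff_cross2 q_def r_def .
  \<comment> \<open>Cramer's rule for the two bisector equations, whose determinant is
    \<open>cross2 q r\<close>.\<close>
  define W where
    "W = P + (1 / (2 * cross2 q r)) *\<^sub>R ((r \<bullet> r) *\<^sub>R perp q - (q \<bullet> q) *\<^sub>R perp r)"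
  have W1: "dist W P = dist W Q" "dist W P = dist W R"
    unfolding dist_eq_iff_inner q_def[symmetric] r_def[symmetric]
    using k by (simp_all add: W_def inner_real2 field_simps) (simp_all add: cross2_def algebra_simps)
  have uniq: "W' = W" if "dist W' P = dist W' Q" "dist W' P = dist W' R" for W'
  proof -
    have "(W' - W) \<bullet> q = 0" "(W' - W) \<bullet> r = 0"
      using that W1 unfolding dist_eq_iff_inner q_def[symmetric] r_def[symmetric]
      by (simp_all add: inner_diff_left)
    then have "cross2 q r * (W' - W)$1 = 0" "cross2 q r * (W' - W)$2 = 0"
      unfolding cross2_def inner_real2 by algebra+
    then show ?thesis using k by (simp add: eq_real2_iff)
  qed
  have "circumcenter P Q R = W"
    unfolding circumcenter_def
  proof (rule the_equality)
    show "\<exists>\<rho>. {P, Q, R} \<subseteq> sphere W \<rho>"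
      using W1 by (auto intro!: exI[of _ "dist W P"])
    show "W' = W" if "\<exists>\<rho>. {P, Q, R} \<subseteq> sphere W' \<rho>" for W'
      using that by (intro uniq) auto
  qed
  then show "dist (circumcenter P Q R) P = dist (circumcenter P Q R) Q"
    and "dist (circumcenter P Q R) P = dist (circumcenter P Q R) R" using W1 by auto
qed

section \<open>Rational parametrisation of the circle\<close>

text \<open>Stereographic projection from \<open>C\<close>, inverted: it maps the line onto the circle through \<open>C\<close>
  with centre \<open>C + w\<close>, with \<open>C\<close> removed.\<close>

definition circ_param :: "real^2 \<Rightarrow> real^2 \<Rightarrow> real \<Rightarrow> real^2" where
  "circ_param C w t = C + (2 / (1 + t\<^sup>2)) *\<^sub>R (w + t *\<^sub>R perp w)"

text \<open>The tangent of the directed angle from \<open>w\<close> to \<open>X - C\<close>. At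
  \<open>X = C\<close> it takes the value \<open>0 / 0 = 0\<close>, so inversion is stated away from
  \<open>C\<close>.\<close>

definition circ_coord :: "real^2 \<Rightarrow> real^2 \<Rightarrow> real^2 \<Rightarrow> real" where
  "circ_coord C w X = ((X - C) \<bullet> perp w) / ((X - C) \<bullet> w)"

lemma one_plus_square_real [simp]: "1 + t\<^sup>2 \<noteq> 0" "0 < 1 + t\<^sup>2" for t :: real
  by (smt (verit) zero_le_power2)+

lemma circ_param_diff_inner:
  "(circ_param C w t - C) \<bullet> w = 2 * (w \<bullet> w) / (1 + t\<^sup>2)"
  "(circ_param C w t - C) \<bullet> perp w = 2 * t * (w \<bullet> w) / (1 + t\<^sup>2)"
  "(circ_param C w t - C) \<bullet> (circ_param C w t - C) = 4 * (w \<bullet> w) / (1 + t\<^sup>2)"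
proof -
  have w: "w \<bullet> perp w = 0" "perp w \<bullet> w = 0" "perp w \<bullet> perp w = w \<bullet> w" by (simp_all add: inner_real2)
  show "(circ_param C w t - C) \<bullet> w = 2 * (w \<bullet> w) / (1 + t\<^sup>2)"
    "(circ_param C w t - C) \<bullet> perp w = 2 * t * (w \<bullet> w) / (1 + t\<^sup>2)"
    using w by (simp_all add: circ_param_def inner_left_distrib)
  have "(w + t *\<^sub>R perp w) \<bullet> (w + t *\<^sub>R perp w) = (1 + t\<^sup>2) * (w \<bullet> w)"
    using w by (simp add: inner_left_distrib inner_right_distrib
        power2_eq_square algebra_simps)
  then show "(circ_param C w t - C) \<bullet> (circ_param C w t - C) = 4 * (w \<bullet> w) / (1 + t\<^sup>2)"
    by (simp add: circ_param_def)
qed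

lemma circ_coord_param [simp]: "w \<noteq> 0 \<Longrightarrow> circ_coord C w (circ_param C w t) = t"
  by (simp add: circ_coord_def circ_param_diff_inner)

text \<open>With the origin moved to the point \<open>C\<close> of the circle, the constant term of
  its equation disappears.\<close>

lemma mem_sphere_iff_chord:
  fixes X C w :: "'a::real_inner"
  shows "X \<in> sphere (C + w) (norm w) \<longleftrightarrow> (X - C) \<bullet> (X - C) = 2 * ((X - C) \<bullet> w)"
proof -
  have "X \<in> sphere (C + w) (norm w) \<longleftrightarrow> norm (X - C - w) = norm w"
    by (metis (no_types) diff_diff_eq dist_commute dist_norm mem_sphere)
  also have "\<dots> \<longleftrightarrow> (X - C) \<bullet> (X - C) = 2 * ((X - C) \<bullet> w)"
    by (auto simp: norm_eq inner_diff_left inner_diff_right inner_commute)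
  finally show ?thesis .
qed

lemma circ_param_in_sphere: "circ_param C w t \<in> sphere (C + w) (norm w)"
  unfolding mem_sphere_iff_chord by (simp add: circ_param_diff_inner)

lemma circ_param_neq: "w \<noteq> 0 \<Longrightarrow> circ_param C w t \<noteq> C"
  using circ_param_diff_inner(3)[of C w t] by auto

text \<open>Put \<open>x = X - C\<close> and let \<open>t\<close> be its coordinate. Expansion in
  the orthogonal basis \<open>w\<close>, \<open>perp w\<close> shows that \<open>x\<close> is a
  multiple of \<open>w + t *\<^sub>R perp w\<close>; the circle equation gives the factor.\<close>

lemma circ_param_coord:
  assumes "X \<in> sphere (C + w) (norm w)" "X \<noteq> C" "w \<noteq> 0"
  shows "circ_param C w (circ_coord C w X) = X"
proof -
  define x where "x = X - C"
  have x: "x \<bullet> x = 2 * (x \<bullet> w)" "x \<noteq> 0"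
    using assms by (simp_all add: x_def flip: mem_sphere_iff_chord)
  have xw: "x \<bullet> w \<noteq> 0" using x by auto
  have ww: "w \<bullet> w \<noteq> 0" using assms by simp
  define t where "t = (x \<bullet> perp w) / (x \<bullet> w)"
  have "(x \<bullet> w)\<^sup>2 + (x \<bullet> perp w)\<^sup>2 = (x \<bullet> x) * (w \<bullet> w)"
    unfolding inner_real2 by (simp add: power2_eq_square algebra_simps)
  then have t: "(1 + t\<^sup>2) * (x \<bullet> w) = 2 * (w \<bullet> w)"
    using x xw by (simp add: t_def field_simps power2_eq_square)
  have t2: "t * (x \<bullet> w) = x \<bullet> perp w" using xw by (simp add: t_def)
  have "(1 + t\<^sup>2) * x$1 = 2 * (w + t *\<^sub>R perp w)$1" "(1 + t\<^sup>2) * x$2 = 2 * (w + t *\<^sub>R perp w)$2"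
  proof -
    have "(x \<bullet> w) * ((w + t *\<^sub>R perp w)$1) = (w \<bullet> w) * x$1"
      "(x \<bullet> w) * ((w + t *\<^sub>R perp w)$2) = (w \<bullet> w) * x$2"
      using t2 unfolding inner_real2 vector_add_component vector_scaleR_component perp_nth real_scaleR_def
      by algebra+
    then have "(x \<bullet> w) * ((1 + t\<^sup>2) * x$1) = (x \<bullet> w) * (2 * (w + t *\<^sub>R perp w)$1)"
      "(x \<bullet> w) * ((1 + t\<^sup>2) * x$2) = (x \<bullet> w) * (2 * (w + t *\<^sub>R perp w)$2)"
      using t by algebra+
    then show "(1 + t\<^sup>2) * x$1 = 2 * (w + t *\<^sub>R perp w)$1" "(1 + t\<^sup>2) * x$2 = 2 * (w + t *\<^sub>R perp w)$2"
      using xw by (simp_all only: mult_cancel_left) auto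
  qed
  moreover have "y = 2 / d * z" if "d * y = 2 * z" "d \<noteq> 0" for d y z :: real
    using that by (simp add: field_simps)
  ultimately have "x = (2 / (1 + t\<^sup>2)) *\<^sub>R (w + t *\<^sub>R perp w)"
    unfolding eq_real2_iff vector_scaleR_component real_scaleR_def
    using one_plus_square_real(1) by blast
  then show ?thesis
    unfolding circ_param_def circ_coord_def t_def x_def by (metis add.commute diff_add_cancel)
qed

lemma continuous_on_circ_param: "continuous_on T (circ_param C w)"
  unfolding circ_param_def by (intro continuous_intros) auto

lemma inj_circ_param: "w \<noteq> 0 \<Longrightarrow> inj (circ_param C w)"
  by (metis injI circ_coord_param)

lemma continuous_on_circ_coord:
  assumes "w \<noteq> 0"
  shows "continuous_on (sphere (C + w) (norm w) - {C}) (circ_coord C w)"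
  unfolding circ_coord_def
proof (intro continuous_intros ballI)
  fix X assume "X \<in> sphere (C + w) (norm w) - {C}"
  then show "(X - C) \<bullet> w \<noteq> 0"
    using mem_sphere_iff_chord[of X C w] by auto
qed

section \<open>The arc as an interval of parameters\<close>

text \<open>The coordinate along a path is continuous and injective, hence monotone, so it stays
  between its end values \<open>a\<close> and \<open>b\<close>. Conversely, the image of the line
  path from \<open>a\<close> to \<open>b\<close> is one path that passes through every point
  claimed.\<close>

lemma minor_arc_eq_image:
  assumes w: "w \<noteq> 0" and ab: "a \<noteq> b"
  shows "minor_arc (sphere (C + w) (norm w)) (circ_param C w a) (circ_param C w b) C
           = circ_param C w ` closed_segment a b" (is "?M = ?P ` _")
proof (intro equalityI subsetI)
  fix X assume "X \<in> ?M"
  then obtain g where g: "arc g" "pathstart g = ?P a" "pathfinish g = ?P b"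
    "path_image g \<subseteq> sphere (C + w) (norm w)" "C \<notin> path_image g" "X \<in> path_image g"
    by (auto simp: minor_arc_def)
  obtain s where s: "s \<in> {0..1}" "X = g s" using g(6) by (auto simp: path_image_def)
  define h where "h = circ_coord C w \<circ> g"
  have im: "g ` {0..1} \<subseteq> sphere (C + w) (norm w) - {C}"
    using g(4,5) by (auto simp: path_image_def)
  have Ph: "?P (h u) = g u" if "u \<in> {0..1}" for u
  proof -
    have "g u \<in> sphere (C + w) (norm w) - {C}" using that im by blast
    then show ?thesis using w by (auto simp: h_def intro!: circ_param_coord)
  qed
  have cont: "continuous_on {0..1} h"
    unfolding h_def using g(1) im
    by (intro continuous_on_compose continuous_on_subset[OF continuous_on_circ_coord[OF w]])
      (auto simp: arc_def path_def)
  have inj: "inj_on h {0..1}"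
    using g(1) Ph by (metis arc_def inj_on_def)
  have h01: "h 0 = a" "h 1 = b"
    using g(2,3) w by (simp_all add: h_def pathstart_def pathfinish_def)
  have "h s \<in> closed_segment a b"
  proof (cases "s = 0 \<or> s = 1")
    case True
    then show ?thesis using h01 by auto
  next
    case False
    then have "0 < s" "s < 1" using s by auto
    from continuous_inj_imp_mono[OF this cont inj] show ?thesis
      unfolding h01 by (auto simp: closed_segment_eq_real_ivl)
  qed
  then show "X \<in> ?P ` closed_segment a b" using Ph s by force
next
  fix X assume X: "X \<in> ?P ` closed_segment a b"
  define g where "g = ?P \<circ> linepath a b"
  have "arc g"
    unfolding arc_def
  proof
    show "path g"
      unfolding g_def by (intro path_continuous_image continuous_on_circ_param) simp
    show "inj_on g {0..1}"
      unfolding g_def using ab w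
      by (intro comp_inj_on inj_on_subset[OF inj_circ_param])
        (auto simp: inj_on_linepath)
  qed
  moreover have "path_image g = ?P ` closed_segment a b"
    by (simp add: g_def path_image_compose)
  ultimately show "X \<in> ?M"
    unfolding minor_arc_def using X w circ_param_in_sphere circ_param_neq
    by (auto intro!: exI[of _ g] simp: g_def pathstart_compose pathfinish_compose)
      (metis circ_param_neq)
qed

section \<open>Cross products and distances on the circle, and the side of a chord\<close>

lemma cross2_circ_param:
  "cross2 (circ_param C w a - C) (circ_param C w b - C)
     = 4 * (w \<bullet> w) * (b - a) / ((1 + a\<^sup>2) * (1 + b\<^sup>2))"
proof -
  have "cross2 (w + a *\<^sub>R perp w) (w + b *\<^sub>R perp w) = (b - a) * (w \<bullet> w)"
    by (simp add: cross2_def inner_real2 algebra_simps)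
  moreover have "cross2 (c *\<^sub>R p) (d *\<^sub>R q) = c * d * cross2 p q" for c d p q
    by (simp add: cross2_def algebra_simps)
  ultimately show ?thesis
    by (simp add: circ_param_def)
qed

text \<open>The signed area is split into three triangles with apex \<open>C\<close>; their sum has
  a numerator that factors. The factor \<open>(t - a) * (t - b)\<close> records the side of the
  chord.\<close>

lemma cross2_circ_param_triangle:
  "cross2 (circ_param C w b - circ_param C w a) (circ_param C w t - circ_param C w a)
     = 4 * (w \<bullet> w) * (b - a) * ((t - a) * (t - b)) / ((1 + a\<^sup>2) * (1 + b\<^sup>2) * (1 + t\<^sup>2))"
proof -
  define p where "p s = circ_param C w s - C" for s
  have nz: "1 + a\<^sup>2 \<noteq> 0" "1 + b\<^sup>2 \<noteq> 0" "1 + t\<^sup>2 \<noteq> 0" by simp_all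
  have "cross2 (p b - p a) (p t - p a) = cross2 (p a) (p b) + cross2 (p b) (p t) + cross2 (p t) (p a)"
    by (simp add: cross2_def algebra_simps)
  also have "\<dots> = 4 * (w \<bullet> w) * ((b - a) / ((1 + a\<^sup>2) * (1 + b\<^sup>2))
      + (t - b) / ((1 + b\<^sup>2) * (1 + t\<^sup>2)) + (a - t) / ((1 + t\<^sup>2) * (1 + a\<^sup>2)))"
    by (simp add: p_def cross2_circ_param ring_distribs)
  also have "(b - a) / ((1 + a\<^sup>2) * (1 + b\<^sup>2))
      + (t - b) / ((1 + b\<^sup>2) * (1 + t\<^sup>2)) + (a - t) / ((1 + t\<^sup>2) * (1 + a\<^sup>2))
      = ((b - a) * (1 + t\<^sup>2) + (t - b) * (1 + a\<^sup>2) + (a - t) * (1 + b\<^sup>2))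
        / ((1 + a\<^sup>2) * (1 + b\<^sup>2) * (1 + t\<^sup>2))"
  proof -
    have "f / (x * y) + g / (y * z) + h / (z * x) = (f * z + g * x + h * y) / (x * y * z)"
      if "x \<noteq> 0" "y \<noteq> 0" "z \<noteq> 0" for f g h x y z :: real
      using that by (simp add: field_simps)
    from this[OF nz(1,2,3)] show ?thesis .
  qed
  also have "(b - a) * (1 + t\<^sup>2) + (t - b) * (1 + a\<^sup>2) + (a - t) * (1 + b\<^sup>2)
      = (b - a) * ((t - a) * (t - b))"
    by algebra
  finally show ?thesis by (simp add: p_def)
qed

lemma circ_param_dist_sq:
  "(circ_param C w b - circ_param C w a) \<bullet> (circ_param C w b - circ_param C w a)
     = 4 * (w \<bullet> w) * (b - a)\<^sup>2 / ((1 + a\<^sup>2) * (1 + b\<^sup>2))"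
proof -
  define p where "p s = circ_param C w s - C" for s
  have nz: "1 + a\<^sup>2 \<noteq> 0" "1 + b\<^sup>2 \<noteq> 0" by simp_all
  have "(w + a *\<^sub>R perp w) \<bullet> (w + b *\<^sub>R perp w) = (1 + a * b) * (w \<bullet> w)"
    by (simp add: inner_real2 algebra_simps)
  then have ab: "p a \<bullet> p b = 4 * (w \<bullet> w) * ((1 + a * b) / ((1 + a\<^sup>2) * (1 + b\<^sup>2)))"
    by (simp add: p_def circ_param_def mult_ac)
  have "(p b - p a) \<bullet> (p b - p a) = p a \<bullet> p a + p b \<bullet> p b - 2 * (p a \<bullet> p b)"
    by (simp add: inner_diff_left inner_diff_right inner_commute)
  also have "\<dots> = 4 * (w \<bullet> w) * (1 / (1 + a\<^sup>2) + 1 / (1 + b\<^sup>2)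
      - 2 * ((1 + a * b) / ((1 + a\<^sup>2) * (1 + b\<^sup>2))))"
    unfolding ab by (simp add: p_def circ_param_diff_inner ring_distribs)
  also have "1 / (1 + a\<^sup>2) + 1 / (1 + b\<^sup>2) - 2 * ((1 + a * b) / ((1 + a\<^sup>2) * (1 + b\<^sup>2)))
      = ((1 + b\<^sup>2) + (1 + a\<^sup>2) - 2 * (1 + a * b)) / ((1 + a\<^sup>2) * (1 + b\<^sup>2))"
  proof -
    have "1 / x + 1 / y - 2 * (f / (x * y)) = (y + x - 2 * f) / (x * y)"
      if "x \<noteq> 0" "y \<noteq> 0" for f x y :: real
      using that by (simp add: field_simps)
    from this[OF nz] show ?thesis .
  qed
  also have "(1 + b\<^sup>2) + (1 + a\<^sup>2) - 2 * (1 + a * b) = (b - a)\<^sup>2"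
    by algebra
  finally show ?thesis by (simp add: p_def)
qed

lemma sphere_obtain_circ_param:
  assumes "C \<in> sphere Z r" "X \<in> sphere Z r" "X \<noteq> C"
  obtains t where "X = circ_param C (Z - C) t"
proof
  have "Z - C \<noteq> 0" using assms by auto
  moreover have "X \<in> sphere (C + (Z - C)) (norm (Z - C))"
    using assms by (simp add: dist_norm)
  ultimately show "X = circ_param C (Z - C) (circ_coord C (Z - C) X)"
    using circ_param_coord assms by metis
qed

text \<open>In absolute value this is the formula abc / (4R) for the area of a triangle: with it
  both sides become (AC BC AX BX AB^2 CX^2) / (4R^2). The parametrisation also settles the
  signs.\<close>

lemma concyclic_cross2:
  assumes "A \<in> sphere Z r" "B \<in> sphere Z r" "C \<in> sphere Z r" "X \<in> sphere Z r"
    and "A \<noteq> C" "B \<noteq> C" "X \<noteq> C"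
  shows "cross2 (A - C) (X - C) * cross2 (B - C) (X - C) * ((B - A) \<bullet> (B - A))
       = cross2 (B - A) (C - A) * cross2 (B - A) (X - A) * ((X - C) \<bullet> (X - C))"
proof -
  define w where "w = Z - C"
  obtain a b t where p: "A = circ_param C w a" "B = circ_param C w b" "X = circ_param C w t"
    unfolding w_def using sphere_obtain_circ_param assms by metis
  have c: "cross2 (B - A) (C - A) = cross2 (A - C) (B - C)"
    by (simp add: cross2_def algebra_simps)
  define x y z where "x = 1 + a\<^sup>2" and "y = 1 + b\<^sup>2" and "z = 1 + t\<^sup>2"
  have nz: "x \<noteq> 0" "y \<noteq> 0" "z \<noteq> 0" by (simp_all add: x_def y_def z_def)
  show ?thesis
    unfolding c unfolding p cross2_circ_param cross2_circ_param_triangle circ_param_dist_sq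
      circ_param_diff_inner x_def[symmetric] y_def[symmetric] z_def[symmetric]
    using nz by (simp add: power2_eq_square mult_ac) (simp add: algebra_simps)
qed

text \<open>\<open>X\<close> is interior to the arc when its parameter lies strictly between those
  of \<open>A\<close> and \<open>B\<close>, that is when \<open>(t - a) * (t - b) < 0\<close>; the
  product of cross products is a positive multiple of this.\<close>

lemma open_minor_arc_iff:
  assumes on: "A \<in> sphere Z r" "B \<in> sphere Z r" "C \<in> sphere Z r"
    and ne: "A \<noteq> B" "A \<noteq> C" "B \<noteq> C"
  shows "X \<in> minor_arc (sphere Z r) A B C - {A, B} \<longleftrightarrow>
    X \<in> sphere Z r \<and> cross2 (B - A) (X - A) * cross2 (B - A) (C - A) < 0"
proof (cases "X \<in> sphere Z r \<and> X \<noteq> C")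
  \<comment> \<open>Off the circle both sides fail. At \<open>X = C\<close> they fail too: the arc
    misses \<open>C\<close>, and a square is not negative.\<close>
  case False
  then show ?thesis
    by (auto simp: minor_arc_def mult_less_0_iff)
next
  case True
  define w where "w = Z - C"
  have w: "w \<noteq> 0" using on ne by (auto simp: w_def)
  have sph: "sphere Z r = sphere (C + w) (norm w)"
    using on by (simp add: w_def dist_norm)
  obtain a b t where p: "A = circ_param C w a" "B = circ_param C w b" "X = circ_param C w t"
    unfolding w_def using sphere_obtain_circ_param True on ne by metis
  have ab: "a \<noteq> b" using ne p by auto
  have eq: "circ_param C w s = circ_param C w s' \<longleftrightarrow> s = s'" for s s'
    using inj_circ_param[OF w] by (simp add: inj_eq)
  have "X \<in> minor_arc (sphere Z r) A B C - {A, B} \<longleftrightarrow> t \<in> open_segment a b"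
    unfolding sph p minor_arc_eq_image[OF w ab] open_segment_def
    using inj_circ_param[OF w] by (auto simp: eq inj_image_mem_iff)
  also have "\<dots> \<longleftrightarrow> (t - a) * (t - b) < 0"
    by (auto simp: open_segment_eq_real_ivl mult_less_0_iff)
  also have "\<dots> \<longleftrightarrow> cross2 (B - A) (X - A) * cross2 (B - A) (C - A) < 0"
  proof -
    define k where "k = (4 * (w \<bullet> w) * (b - a) / ((1 + a\<^sup>2) * (1 + b\<^sup>2)))\<^sup>2 / (1 + t\<^sup>2)"
    have "cross2 (B - A) (C - A) = cross2 (A - C) (B - C)"
      by (simp add: cross2_def algebra_simps)
    then have "cross2 (B - A) (X - A) * cross2 (B - A) (C - A) = k * ((t - a) * (t - b))"
      unfolding k_def p cross2_circ_param cross2_circ_param_triangle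
      by (simp add: power2_eq_square mult_ac)
    moreover have "k > 0"
      unfolding k_def using w ab
      by (intro divide_pos_pos) (simp_all only: zero_less_power2 one_plus_square_real, simp)
    ultimately show ?thesis by (metis mult_less_0_iff less_asym)
  qed
  finally show ?thesis using True by simp
qed

section \<open>Intersection of the two chords\<close>

text \<open>The power of the point dividing the chord \<open>PQ\<close> in the ratio s : (1 - s) is
  \<open>- s * (1 - s)\<close> times the squared chord length.\<close>

lemma chord_power:
  fixes P Q Z :: "'a::euclidean_space"
  assumes "P \<in> sphere Z r" "Q \<in> sphere Z r"
  shows "(P + s *\<^sub>R (Q - P) - Z) \<bullet> (P + s *\<^sub>R (Q - P) - Z)
       = r\<^sup>2 - s * (1 - s) * ((Q - P) \<bullet> (Q - P))"
proof -
  define p d where "p = P - Z" and "d = Q - P"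
  have pp: "p \<bullet> p = r\<^sup>2"
    using assms(1) by (simp add: p_def dist_norm norm_minus_commute flip: power2_norm_eq_inner)
  have "(p + d) \<bullet> (p + d) = r\<^sup>2"
    using assms(2) by (simp add: p_def d_def dist_norm norm_minus_commute flip: power2_norm_eq_inner)
  then have pd: "2 * (p \<bullet> d) = - (d \<bullet> d)"
    using pp by (simp add: inner_left_distrib inner_right_distrib inner_commute)
  have "(p + s *\<^sub>R d) \<bullet> (p + s *\<^sub>R d) = p \<bullet> p + s * (2 * (p \<bullet> d)) + s * s * (d \<bullet> d)"
    by (simp add: inner_left_distrib inner_right_distrib inner_commute)
  also have "\<dots> = r\<^sup>2 - s * (1 - s) * (d \<bullet> d)"
    unfolding pd pp by (simp add: algebra_simps)
  finally show ?thesis by (simp add: p_def d_def algebra_simps)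
qed

text \<open>Along \<open>CX\<close> the signed distance to the line \<open>AB\<close> is affine and
  changes sign, which gives \<open>s\<close>. Both chords yield the same power at the intersection
  point, so \<open>t * (1 - t)\<close> is positive as well and the point is inside
  \<open>AB\<close>.\<close>

lemma segments_meet_chords:
  assumes on: "A \<in> sphere Z r" "B \<in> sphere Z r" "C \<in> sphere Z r" "X \<in> sphere Z r"
    and opp: "cross2 (B - A) (X - A) * cross2 (B - A) (C - A) < 0"
  obtains s t where "0 < s" "s < 1" "0 < t" "t < 1"
    "segments_meet C X A B = C + s *\<^sub>R (X - C)" "segments_meet C X A B = A + t *\<^sub>R (B - A)"
proof -
  define l where "l Y = cross2 (B - A) (Y - A)" for Y
  define s where "s = l C / (l C - l X)"
  define D where "D = C + s *\<^sub>R (X - C)"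
  have opp': "l X * l C < 0" using opp by (simp add: l_def)
  have ne: "l C \<noteq> l X" using opp' by (auto simp: mult_less_0_iff)
  have s: "0 < s" "s < 1"
    using opp' by (auto simp: s_def mult_less_0_iff divide_simps)
  have l_line: "l (C + s' *\<^sub>R (X - C)) = l C + s' * (l X - l C)" for s'
    by (simp add: l_def cross2_def algebra_simps)
  have AB: "B - A \<noteq> 0" using opp by (auto simp: cross2_def)
  have CX: "X - C \<noteq> 0" using ne by auto
  have "cross2 (B - A) (D - A) = 0"
    using l_line[of s] ne unfolding D_def[symmetric] by (simp add: l_def[symmetric] s_def divide_simps) algebra
  then obtain t where "D - A = t *\<^sub>R (B - A)"
    using AB by (rule cross2_eq_0_imp_scaleR)
  then have D: "D = A + t *\<^sub>R (B - A)" by (simp add: algebra_simps)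
  have "t * (1 - t) * ((B - A) \<bullet> (B - A)) = s * (1 - s) * ((X - C) \<bullet> (X - C))"
    using chord_power[OF on(1,2), of t] chord_power[OF on(3,4), of s]
    unfolding D_def[symmetric] D[symmetric] by linarith
  also have "\<dots> > 0" using s CX by simp
  finally have "t * (1 - t) > 0"
    using AB by (metis inner_gt_zero_iff zero_less_mult_pos2)
  then have t: "0 < t" "t < 1" by (auto simp: zero_less_mult_iff)
  have seg: "Y \<in> closed_segment P Q \<longleftrightarrow> (\<exists>u. 0 \<le> u \<and> u \<le> 1 \<and> Y = P + u *\<^sub>R (Q - P))"
    for Y P Q :: "real^2"
    by (auto simp: in_segment algebra_simps)
  have "segments_meet C X A B = D"
    unfolding segments_meet_def
  proof (rule the_equality)
    show "D \<in> closed_segment C X \<inter> closed_segment A B"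
      unfolding Int_iff seg using s t D D_def by (auto intro: less_imp_le)
    fix D' assume "D' \<in> closed_segment C X \<inter> closed_segment A B"
    then obtain s' t' where D': "D' = C + s' *\<^sub>R (X - C)" "D' = A + t' *\<^sub>R (B - A)"
      unfolding Int_iff seg by blast
    have "l D' = 0" by (simp add: D'(2) l_def cross2_def)
    then have "s' * (l C - l X) = l C" unfolding D'(1) l_line by (simp add: algebra_simps)
    then have "s' = s" using ne by (simp add: s_def field_simps)
    then show "D' = D" by (simp add: D'(1) D_def)
  qed
  then show ?thesis using that[OF s t] D D_def by simp
qed

section \<open>The area of the triangle of centers\<close>

lemma equidistant_pair_inner:
  fixes V W P Y :: "'a::real_inner"
  assumes "dist V P = dist V Y" "dist W P = dist W Y"
  shows "(V - W) \<bullet> (Y - P) = 0"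
  using assms unfolding dist_eq_iff_inner by (simp add: inner_diff_left)

text \<open>A triangle with sides \<open>p\<close>, \<open>q\<close>, \<open>p - q\<close> of known
  directions is fixed up to a scale \<gamma>. Crossing the relation between the sides with
  \<open>a\<close> and with \<open>b\<close> expresses \<alpha> and \<beta> through \<gamma>, and
  the projection onto \<open>u\<close> determines \<gamma>.\<close>

lemma cross2_of_side_directions:
  assumes p: "p \<bullet> a = 0" and q: "q \<bullet> b = 0" and pq: "(p - q) \<bullet> v = 0"
    and u: "2 * ((p - q) \<bullet> u) = - (u \<bullet> u)"
    and nz: "a \<noteq> 0" "b \<noteq> 0" "v \<noteq> 0"
  shows "4 * (cross2 u v)\<^sup>2 * (cross2 p q * cross2 a b)
       = (u \<bullet> u)\<^sup>2 * (cross2 v a * cross2 v b)"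
proof -
  obtain \<alpha> where \<alpha>: "p = \<alpha> *\<^sub>R perp a" using orthogonal_imp_perp[OF p nz(1)] .
  obtain \<beta> where \<beta>: "q = \<beta> *\<^sub>R perp b" using orthogonal_imp_perp[OF q nz(2)] .
  obtain \<gamma> where \<gamma>: "p - q = \<gamma> *\<^sub>R perp v" using orthogonal_imp_perp[OF pq nz(3)] .
  have e: "\<alpha> * a$1 - \<beta> * b$1 = \<gamma> * v$1" "\<alpha> * a$2 - \<beta> * b$2 = \<gamma> * v$2"
    using \<gamma> unfolding \<alpha> \<beta> by (simp_all add: eq_real2_iff)
  have ab: "\<alpha> * cross2 a b = \<gamma> * cross2 v b" "\<beta> * cross2 a b = \<gamma> * cross2 v a"
    using e unfolding cross2_def by algebra+
  have \<gamma>u: "2 * \<gamma> * cross2 u v = u \<bullet> u"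
    using u unfolding \<gamma> by (simp add: inner_real2 cross2_def algebra_simps)
  have "cross2 p q = \<alpha> * \<beta> * cross2 a b"
    unfolding \<alpha> \<beta> by (simp add: cross2_def algebra_simps)
  then have "cross2 p q * cross2 a b = (\<alpha> * cross2 a b) * (\<beta> * cross2 a b)" by simp
  also have "\<dots> = \<gamma>\<^sup>2 * (cross2 v a * cross2 v b)"
    unfolding ab by (simp add: power2_eq_square)
  finally have "4 * (cross2 u v)\<^sup>2 * (cross2 p q * cross2 a b)
      = (2 * \<gamma> * cross2 u v)\<^sup>2 * (cross2 v a * cross2 v b)"
    by (simp add: power2_eq_square)
  then show ?thesis unfolding \<gamma>u .
qed

text \<open>The squared quotient is cot^2 of the angle between \<open>AB\<close> and
  \<open>CX\<close>, and 1 + cot^2 = 1 / sin^2. In this form the minimum is read off as the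
  vanishing of an inner product.\<close>

lemma area_OO1O2_eq:
  assumes on: "A \<in> sphere Z r" "B \<in> sphere Z r" "C \<in> sphere Z r" "X \<in> sphere Z r"
    and opp: "cross2 (B - A) (X - A) * cross2 (B - A) (C - A) < 0"
  shows "cross2 (B - A) (X - C) \<noteq> 0"
    and "area_OO1O2 Z A B C X = \<bar>cross2 (B - A) (C - A)\<bar> / 8 *
      (1 + (((X - C) \<bullet> (B - A)) / cross2 (B - A) (X - C))\<^sup>2)"
proof -
  define u v where "u = B - A" and "v = X - C"
  define lX lC where "lX = cross2 (B - A) (X - A)" and "lC = cross2 (B - A) (C - A)"
  have opp': "lX * lC < 0" using opp by (simp add: lX_def lC_def)
  have uv: "cross2 u v = lX - lC"
    by (simp add: u_def v_def lX_def lC_def cross2_def algebra_simps)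
  have uv0: "cross2 u v \<noteq> 0" unfolding uv using opp' by (auto simp: mult_less_0_iff)
  then show "cross2 (B - A) (X - C) \<noteq> 0" by (simp add: u_def v_def)
  have lX0: "lX \<noteq> 0" and lC0: "lC \<noteq> 0" using opp' by auto
  have nz: "X \<noteq> A" "X \<noteq> B" "X \<noteq> C" "A \<noteq> C" "B \<noteq> C" "A \<noteq> B"
    using lX0 lC0 uv0 by (auto simp: lX_def lC_def u_def v_def cross2_def)
  obtain s t where st: "0 < s" "s < 1" "0 < t" "t < 1"
    and D1: "segments_meet C X A B = C + s *\<^sub>R (X - C)"
    and D2: "segments_meet C X A B = A + t *\<^sub>R (B - A)"
    by (rule segments_meet_chords[OF on opp])
  define D where "D = segments_meet C X A B"
  define O1 O2 where "O1 = circumcenter A D X" and "O2 = circumcenter B D X"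
  have DA: "D - A = t *\<^sub>R u" and DB: "D - B = - (1 - t) *\<^sub>R u"
    by (simp_all add: D_def D2 u_def algebra_simps)
  have XD: "X - D = (1 - s) *\<^sub>R v" by (simp add: D_def D1 v_def algebra_simps)
  have "cross2 (D - A) (X - A) = t * lX"
    by (simp add: DA lX_def cross2_def u_def algebra_simps)
  then have "\<not> collinear {A, D, X}" using st lX0 by (simp add: collinear_iff_cross2)
  from circumcenter_equidistant[OF this]
  have O1: "dist O1 A = dist O1 D" "dist O1 A = dist O1 X" by (simp_all add: O1_def)
  have "cross2 (D - B) (X - B) = - (1 - t) * lX"
    unfolding DB by (simp add: lX_def cross2_def u_def algebra_simps)
  then have "\<not> collinear {B, D, X}" using st lX0 by (simp add: collinear_iff_cross2)
  from circumcenter_equidistant[OF this]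
  have O2: "dist O2 B = dist O2 D" "dist O2 B = dist O2 X" by (simp_all add: O2_def)
  define p q where "p = O1 - Z" and "q = O2 - Z"
  have p: "p \<bullet> (X - A) = 0"
    unfolding p_def using O1(2) on by (intro equidistant_pair_inner) auto
  have q: "q \<bullet> (X - B) = 0"
    unfolding q_def using O2(2) on by (intro equidistant_pair_inner) auto
  \<comment> \<open>Both centers lie on the perpendicular bisector of the common chord
    \<open>DX\<close>.\<close>
  have "(O1 - O2) \<bullet> (X - D) = 0"
    using O1 O2 by (intro equidistant_pair_inner) auto
  then have pq: "(p - q) \<bullet> v = 0" using st by (simp add: XD p_def q_def)
  have "t * (2 * ((O1 - A) \<bullet> u)) = t * (t * (u \<bullet> u))"
    using O1(1) unfolding dist_eq_iff_inner DA by simp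
  then have 1: "2 * ((O1 - A) \<bullet> u) = t * (u \<bullet> u)" using st by simp
  have "(1 - t) * (2 * ((O2 - B) \<bullet> u)) = (1 - t) * (- (1 - t) * (u \<bullet> u))"
    using O2(1) unfolding dist_eq_iff_inner DB by (simp add: algebra_simps)
  then have 2: "2 * ((O2 - B) \<bullet> u) = - (1 - t) * (u \<bullet> u)" using st by simp
  \<comment> \<open>The shares \<open>t\<close> and \<open>1 - t\<close> of the two projections add
    up to 1, so the position of \<open>D\<close> on \<open>AB\<close> drops out.\<close>
  have "(p - q) \<bullet> u = (O1 - A) \<bullet> u - (O2 - B) \<bullet> u - u \<bullet> u"
    by (simp add: p_def q_def u_def inner_diff_left)
  then have pqu: "2 * ((p - q) \<bullet> u) = - (u \<bullet> u)"
    using 1 2 by (simp add: algebra_simps)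
  have "4 * (cross2 u v)\<^sup>2 * (cross2 p q * cross2 (X - A) (X - B))
      = (u \<bullet> u)\<^sup>2 * (cross2 v (X - A) * cross2 v (X - B))"
    using p q pq pqu nz by (intro cross2_of_side_directions) (auto simp: v_def)
  also have "cross2 (X - A) (X - B) = lX"
    by (simp add: lX_def cross2_def algebra_simps)
  also have "cross2 v (X - A) = cross2 (A - C) (X - C)"
    by (simp add: v_def cross2_def algebra_simps)
  also have "cross2 v (X - B) = cross2 (B - C) (X - C)"
    by (simp add: v_def cross2_def algebra_simps)
  also have "(u \<bullet> u)\<^sup>2 * (cross2 (A - C) (X - C) * cross2 (B - C) (X - C))
      = (u \<bullet> u) * (lC * lX * (v \<bullet> v))"
    using concyclic_cross2[OF on nz(4,5,3)]
    unfolding lX_def[symmetric] lC_def[symmetric]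
    unfolding u_def[symmetric] v_def[symmetric]
    by (simp add: power2_eq_square mult_ac)
  \<comment> \<open>Cancelling \<open>lX\<close> leaves \<open>lC\<close>, twice the signed area of
    \<open>ABC\<close>, which does not depend on \<open>X\<close>.\<close>
  finally have "lX * (4 * (cross2 u v)\<^sup>2 * cross2 p q) = lX * (lC * ((u \<bullet> u) * (v \<bullet> v)))"
    by (simp add: mult_ac)
  then have "4 * (cross2 u v)\<^sup>2 * cross2 p q = lC * ((u \<bullet> u) * (v \<bullet> v))"
    using lX0 by simp
  then have "4 * (cross2 u v)\<^sup>2 * cross2 p q = lC * ((cross2 u v)\<^sup>2 + (u \<bullet> v)\<^sup>2)"
    unfolding cross2_lagrange .
  then have "cross2 p q = lC / 4 * (1 + ((u \<bullet> v) / cross2 u v)\<^sup>2)"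
    using uv0 by (simp add: field_simps)
  then have "\<bar>cross2 p q\<bar> = \<bar>lC\<bar> / 4 * (1 + ((u \<bullet> v) / cross2 u v)\<^sup>2)"
    by (simp only: abs_mult abs_of_pos[OF one_plus_square_real(2)] abs_divide abs_numeral)
  moreover have "area_OO1O2 Z A B C X = \<bar>cross2 p q\<bar> / 2"
    by (simp add: area_OO1O2_def Let_def triangle_area_cross2 p_def q_def O1_def O2_def D_def)
  ultimately show "area_OO1O2 Z A B C X = \<bar>cross2 (B - A) (C - A)\<bar> / 8 *
      (1 + (((X - C) \<bullet> (B - A)) / cross2 (B - A) (X - C))\<^sup>2)"
    by (simp add: lC_def u_def v_def inner_commute)
qed

section \<open>Existence of the perpendicular position\<close>

text \<open>The witness is the second intersection of the altitude from \<open>C\<close> with the circle. It is the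
  reflection of the orthocentre in \<open>AB\<close>, so it lies opposite to \<open>C\<close> when the angles at \<open>A\<close> and
  \<open>B\<close> are acute.\<close>

lemma altitude_meets_arc:
  assumes on: "A \<in> sphere Z r" "B \<in> sphere Z r" "C \<in> sphere Z r"
    and acute: "(C - A) \<bullet> (B - A) > 0" "(C - B) \<bullet> (A - B) > 0"
  obtains X where "X \<in> sphere Z r" "(X - C) \<bullet> (B - A) = 0"
    "cross2 (B - A) (X - A) * cross2 (B - A) (C - A) < 0"
proof -
  define u c z where "u = B - A" and "c = C - A" and "z = Z - A"
  have "dist Z A = dist Z B" "dist Z A = dist Z C" using on by auto
  then have uz: "2 * (z \<bullet> u) = u \<bullet> u" and cz: "2 * (z \<bullet> c) = c \<bullet> c"
    unfolding dist_eq_iff_inner by (simp_all add: u_def c_def z_def)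
  have uu: "u \<bullet> u > 0" using acute by (auto simp: u_def)
  \<comment> \<open>The root, other than 0 in general, of the condition that
    \<open>C - k *\<^sub>R perp u\<close> be as far from \<open>Z\<close> as \<open>C\<close> is;
    here \<open>c - z = C - Z\<close>.\<close>
  define k where "k = 2 * ((c - z) \<bullet> perp u) / (u \<bullet> u)"
  define X where "X = C - k *\<^sub>R perp u"
  have k: "k * (u \<bullet> u) = 2 * ((c - z) \<bullet> perp u)" using uu by (simp add: k_def)
  have pu: "perp u \<bullet> perp u = u \<bullet> u" "perp u \<bullet> u = 0" by (simp_all add: inner_real2)
  have "2 * ((Z - C) \<bullet> (X - C)) = k * (2 * ((c - z) \<bullet> perp u))"
    by (simp add: X_def c_def z_def inner_diff_left algebra_simps)
  also have "\<dots> = (X - C) \<bullet> (X - C)"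
    by (simp add: X_def pu flip: k)
  finally have "dist Z C = dist Z X" unfolding dist_eq_iff_inner .
  then have "X \<in> sphere Z r" using on by auto
  moreover have "(X - C) \<bullet> (B - A) = 0" by (simp add: X_def pu flip: u_def)
  \<comment> \<open>The factors on the right are \<open>(C - A) \<bullet> (B - A)\<close> and
    \<open>(C - B) \<bullet> (A - B)\<close>, positive because the angles at \<open>A\<close> and
    \<open>B\<close> are acute.\<close>
  moreover have "cross2 u (X - A) * cross2 u c = - ((c \<bullet> u) * (u \<bullet> u - c \<bullet> u))"
  proof -
    have "cross2 u (X - A) = cross2 u c - k * (u \<bullet> u)"
      by (simp add: X_def c_def cross2_def inner_real2 algebra_simps)
    also have "\<dots> = 2 * cross2 u z - cross2 u c"
      unfolding k by (simp add: cross2_def inner_real2 algebra_simps)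
    finally show ?thesis
      using uz cz unfolding cross2_def inner_real2 by algebra
  qed
  moreover have "(c \<bullet> u) * (u \<bullet> u - c \<bullet> u) > 0"
  proof -
    have "u \<bullet> u - c \<bullet> u = (C - B) \<bullet> (A - B)"
      by (simp add: c_def u_def inner_real2 algebra_simps)
    then show ?thesis using acute by (simp add: c_def u_def)
  qed
  ultimately show ?thesis using that[of X] by (simp add: u_def c_def)
qed

section \<open>The unique minimum on the arc\<close>

theorem mainTheorem1:
  fixes A B C Z :: "real^2" and r :: real and \<omega> S :: "(real^2) set"
  assumes acute: "acute_triangle A B C"
    and circle: "\<omega> = sphere Z r"
    and inscribed: "A \<in> \<omega>" "B \<in> \<omega>" "C \<in> \<omega>"
    and S: "S = minor_arc \<omega> A B C - {A, B}"
  shows "\<exists>X0. {X \<in> S. orthogonal (X - C) (B - A)} = {X0} \<and>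
              {X \<in> S. \<forall>Y \<in> S. area_OO1O2 Z A B C X \<le> area_OO1O2 Z A B C Y} = {X0}"
proof -
  have nc: "\<not> collinear {A, B, C}" using acute by (simp add: acute_triangle_def)
  then have ne: "A \<noteq> B" "A \<noteq> C" "B \<noteq> C" by (auto simp: insert_commute)
  have on: "A \<in> sphere Z r" "B \<in> sphere Z r" "C \<in> sphere Z r"
    using inscribed circle by auto
  define K where "K = \<bar>cross2 (B - A) (C - A)\<bar> / 8"
  have K: "K > 0" using nc by (simp add: K_def collinear_iff_cross2)
  have S_iff: "X \<in> S \<longleftrightarrow> X \<in> sphere Z r \<and> cross2 (B - A) (X - A) * cross2 (B - A) (C - A) < 0" for X
    unfolding S circle by (rule open_minor_arc_iff[OF on ne])
  have area: "area_OO1O2 Z A B C X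
      = K * (1 + (((X - C) \<bullet> (B - A)) / cross2 (B - A) (X - C))\<^sup>2)" if "X \<in> S" for X
    using area_OO1O2_eq(2)[OF on] that unfolding S_iff K_def by blast
  have cross_nz: "cross2 (B - A) (X - C) \<noteq> 0" if "X \<in> S" for X
    using area_OO1O2_eq(1)[OF on] that unfolding S_iff by blast
  have "(C - A) \<bullet> (B - A) > 0" "(C - B) \<bullet> (A - B) > 0"
    using acute ne angle_acute_imp_inner_pos[of B A C] angle_acute_imp_inner_pos[of A B C]
    by (simp_all add: acute_triangle_def inner_commute)
  then obtain X0 where X0: "X0 \<in> S" "(X0 - C) \<bullet> (B - A) = 0"
    using altitude_meets_arc[OF on] S_iff by metis
  \<comment> \<open>The perpendicular to \<open>AB\<close> through \<open>C\<close> meets the circle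
    in at most one further point: \<open>k\<close> and \<open>k0\<close> are nonzero roots of the
    same quadratic, which has 0 as its other root.\<close>
  have uniq: "X = X0" if X: "X \<in> S" "(X - C) \<bullet> (B - A) = 0" for X
  proof -
    have BA: "B - A \<noteq> 0" using ne by simp
    obtain k where k: "X - C = k *\<^sub>R perp (B - A)"
      using orthogonal_imp_perp[OF X(2) BA] .
    obtain k0 where k0: "X0 - C = k0 *\<^sub>R perp (B - A)"
      using orthogonal_imp_perp[OF X0(2) BA] .
    have "cross2 (B - A) 0 = 0" by (simp add: cross2_def)
    then have "X \<noteq> C" "X0 \<noteq> C"
      using cross_nz[OF X(1)] cross_nz[OF X0(1)] by (metis diff_self)+
    then have nz: "k \<noteq> 0" "k0 \<noteq> 0" using k k0 by auto
    have "dist Z C = dist Z X" "dist Z C = dist Z X0" using X X0 on by (auto simp: S_iff)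
    then have "k * (2 * ((Z - C) \<bullet> perp (B - A))) = k * (k * (perp (B - A) \<bullet> perp (B - A)))"
      "k0 * (2 * ((Z - C) \<bullet> perp (B - A))) = k0 * (k0 * (perp (B - A) \<bullet> perp (B - A)))"
      unfolding dist_eq_iff_inner k k0 by simp_all
    then have "k * (perp (B - A) \<bullet> perp (B - A)) = k0 * (perp (B - A) \<bullet> perp (B - A))"
      using nz by (metis mult_left_cancel)
    moreover have "perp (B - A) \<noteq> 0" using BA by (auto simp: eq_real2_iff)
    ultimately have "k = k0" by simp
    then show ?thesis using k k0 by (metis diff_add_cancel)
  qed
  have area_X0: "area_OO1O2 Z A B C X0 = K" using area X0 by simp
  have min: "K \<le> area_OO1O2 Z A B C X" if "X \<in> S" for X
    using area[OF that] K by (simp add: mult_le_cancel_left1)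
  have strict: "X = X0" if "X \<in> S" "area_OO1O2 Z A B C X \<le> K" for X
  proof -
    have "K * (((X - C) \<bullet> (B - A)) / cross2 (B - A) (X - C))\<^sup>2 \<le> 0"
      using area[OF that(1)] that(2) by (simp add: algebra_simps)
    then have "((X - C) \<bullet> (B - A)) / cross2 (B - A) (X - C) = 0"
      using K by (simp add: mult_le_0_iff)
    \<comment> \<open>The denominator is nonzero, so the zero quotient is a genuinely zero inner
      product and not a division by zero.\<close>
    then show ?thesis using uniq cross_nz that by simp
  qed
  have "{X \<in> S. orthogonal (X - C) (B - A)} = {X0}"
    unfolding orthogonal_def using X0 uniq by blast
  moreover have "{X \<in> S. \<forall>Y \<in> S. area_OO1O2 Z A B C X \<le> area_OO1O2 Z A B C Y} = {X0}"
  proof (intro equalityI subsetI)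
    fix X assume "X \<in> {X \<in> S. \<forall>Y \<in> S. area_OO1O2 Z A B C X \<le> area_OO1O2 Z A B C Y}"
    then have "X \<in> S" "area_OO1O2 Z A B C X \<le> K" using X0(1) area_X0 by auto
    then show "X \<in> {X0}" using strict by simp
  next
    fix X assume "X \<in> {X0}"
    then show "X \<in> {X \<in> S. \<forall>Y \<in> S. area_OO1O2 Z A B C X \<le> area_OO1O2 Z A B C Y}"
      using X0(1) area_X0 min by simp
  qed
  ultimately show ?thesis by blast
qed

end
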